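(* Let $\mathcal{S}$ be a Steiner triple system of order $n$, and suppose that the smallest size of a spreading set in $\mathcal{S}$ is $\log_2(n+1)$. Then $\mathcal{S}$ is a projective space over $\mathbb{F}_2$, i.e. $\mathcal{S}$ is isomorphic to the triple system formed by the points and lines of $\mathrm{PG}(d,2)$ for some $d$.
   Context: A Steiner triple system of order $n$ is a nonempty set $V$ of $n$ points together with a family $\mathcal{F}$ of $3$-element subsets (triples) of $V$ such that every pair of distinct points of $V$ is contained in exactly one triple. For $V'\subseteq V$, the set of neighbours $N(V')$ consists of all $z\in V\setminus V'$ for which there exist distinct $x,y\in V'$ with $\{x,y,z\}\in\mathcal{F}$. The closure $\mathrm{cl}(V')$ is the smallest set $W\supseteq V'$ with $N(W)=\emptyset$ (it exists and is unique). A set $V'\subseteq V$ is spreading if $\mathrm{cl}(V')=V$. $\mathrm{PG}(d,2)$ is the $d$-dimensional projective space over $\mathbb{F}_2$; its points (the nonzero vectors of $\mathbb{F}_2^{d+1}$) with its lines as triples (the sets $\{a,b,a+b\}$ with $a\ne b$ nonzero) form a Steiner triple system of order $2^{d+1}-1$. *)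

theory Defs
  imports
    Complex_Main
    "HOL-Library.Z2"
    "Jordan_Normal_Form.Matrix"
begin

locale steiner_triple_system =
  fixes V :: "'a set" and F :: "'a set set"
  assumes finite_points: "finite V"
    and nonempty_points: "V \<noteq> {}"
    and triples: "T \<in> F \<Longrightarrow> T \<subseteq> V \<and> card T = 3"
    and unique_triple: "x \<in> V \<Longrightarrow> y \<in> V \<Longrightarrow> x \<noteq> y \<Longrightarrow> \<exists>!T. T \<in> F \<and> {x, y} \<subseteq> T"

definition neighbours :: "'a set \<Rightarrow> 'a set set \<Rightarrow> 'a set \<Rightarrow> 'a set" where
  "neighbours V F A = {z \<in> V - A. \<exists>x\<in>A. \<exists>y\<in>A. x \<noteq> y \<and> {x, y, z} \<in> F}"

definition sts_closure :: "'a set \<Rightarrow> 'a set set \<Rightarrow> 'a set \<Rightarrow> 'a set" where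
  "sts_closure V F A = (\<lambda>W. W \<subseteq> V \<and> neighbours V F W = {}) hull A"

text \<open>The intersection taken by \<^const>\<open>hull\<close> is indeed the smallest superset without neighbours.\<close>

lemma sts_closure_least:
  assumes "A \<subseteq> V"
  shows "A \<subseteq> sts_closure V F A"
    and "sts_closure V F A \<subseteq> V"
    and "neighbours V F (sts_closure V F A) = {}"
    and "\<And>W. A \<subseteq> W \<Longrightarrow> W \<subseteq> V \<Longrightarrow> neighbours V F W = {} \<Longrightarrow> sts_closure V F A \<subseteq> W"
proof -
  show "A \<subseteq> sts_closure V F A"
    unfolding sts_closure_def by (rule hull_subset)
  have V: "neighbours V F V = {}"
    by (auto simp: neighbours_def)
  show sub: "sts_closure V F A \<subseteq> V"
    unfolding sts_closure_def by (rule hull_minimal) (use assms V in auto)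
  show min: "sts_closure V F A \<subseteq> W"
    if "A \<subseteq> W" "W \<subseteq> V" "neighbours V F W = {}" for W
    unfolding sts_closure_def by (rule hull_minimal) (use that in auto)
  show "neighbours V F (sts_closure V F A) = {}"
  proof (rule ccontr)
    assume "neighbours V F (sts_closure V F A) \<noteq> {}"
    then obtain x y z where z: "z \<in> V" "z \<notin> sts_closure V F A"
      and xy: "x \<in> sts_closure V F A" "y \<in> sts_closure V F A" "x \<noteq> y" "{x, y, z} \<in> F"
      by (auto simp: neighbours_def)
    from z obtain W where W: "A \<subseteq> W" "W \<subseteq> V" "neighbours V F W = {}" "z \<notin> W"
      by (auto simp: sts_closure_def hull_def)
    with min xy have "x \<in> W" "y \<in> W" by blast+
    with z W xy have "z \<in> neighbours V F W" by (auto simp: neighbours_def)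
    with W show False by simp
  qed
qed

definition spreading :: "'a set \<Rightarrow> 'a set set \<Rightarrow> 'a set \<Rightarrow> bool" where
  "spreading V F A \<longleftrightarrow> A \<subseteq> V \<and> sts_closure V F A = V"

text \<open>\<^const>\<open>Least\<close> is meaningful here because \<^term>\<open>V\<close> itself is spreading; for infinite sets
  \<^const>\<open>card\<close> would be junk, but the points of a Steiner triple system are finite in number.\<close>

definition min_spreading_size :: "'a set \<Rightarrow> 'a set set \<Rightarrow> nat" where
  "min_spreading_size V F = (LEAST k. \<exists>A. spreading V F A \<and> card A = k)"

lemma spreading_points: "spreading V F V"
  unfolding spreading_def using sts_closure_least(1,2)[of V V F] by auto

definition sts_isomorphic :: "'a set \<Rightarrow> 'a set set \<Rightarrow> 'b set \<Rightarrow> 'b set set \<Rightarrow> bool" where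
  "sts_isomorphic V F V' F' \<longleftrightarrow> (\<exists>f. bij_betw f V V' \<and> (\<lambda>T. f ` T) ` F = F')"

text \<open>\<open>PG(d,2)\<close>, with vectors of length \<open>d + 1\<close> over the two-element field \<^typ>\<open>bit\<close>.\<close>

definition PG_points :: "nat \<Rightarrow> bit vec set" where
  "PG_points d = carrier_vec (d + 1) - {0\<^sub>v (d + 1)}"

definition PG_lines :: "nat \<Rightarrow> bit vec set set" where
  "PG_lines d = {{a, b, a + b} | a b. a \<in> PG_points d \<and> b \<in> PG_points d \<and> a \<noteq> b}"

lemma finite_carrier_vec_bit: "finite (carrier_vec n :: bit vec set)"
proof -
  have U: "(UNIV :: bit set) = {0, 1}" by (auto simp: bit_not_zero_iff)
  have fin: "finite {xs :: bit list. set xs \<subseteq> UNIV \<and> length xs = n}"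
    by (rule finite_lists_length_eq) (simp add: U)
  have "carrier_vec n \<subseteq> vec_of_list ` {xs :: bit list. set xs \<subseteq> UNIV \<and> length xs = n}"
  proof
    fix v :: "bit vec" assume "v \<in> carrier_vec n"
    then have "v = vec_of_list (list_of_vec v)" "length (list_of_vec v) = n"
      by (simp_all add: vec_list)
    then show "v \<in> vec_of_list ` {xs. set xs \<subseteq> UNIV \<and> length xs = n}" by blast
  qed
  with fin show ?thesis by (rule finite_surj)
qed

lemma bit_vec_cancel:
  fixes a b :: "bit vec"
  assumes "a \<in> carrier_vec n" "b \<in> carrier_vec n"
  shows "a + (a + b) = b" and "a + b = 0\<^sub>v n \<longleftrightarrow> a = b"
proof -
  have eq: "x + (x + y) = y" "x + y = 0 \<longleftrightarrow> x = y" for x y :: bit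
    by (cases x; cases y; simp)+
  show "a + (a + b) = b"
    using assms by (intro eq_vecI) (auto simp: eq)
  show "a + b = 0\<^sub>v n \<longleftrightarrow> a = b"
    using assms by (auto simp: vec_eq_iff eq carrier_vecD)
qed

lemma steiner_triple_system_PG: "steiner_triple_system (PG_points d) (PG_lines d)"
proof
  show "finite (PG_points d)"
    by (simp add: PG_points_def finite_carrier_vec_bit)
  have "unit_vec (d + 1) 0 \<noteq> (0\<^sub>v (d + 1) :: bit vec)"
    by (metis add_gr_0 index_unit_vec(2) index_zero_vec(1) less_one one_neq_zero)
  then show "PG_points d \<noteq> {}"
    unfolding PG_points_def by (metis Diff_iff empty_iff singletonD unit_vec_carrier)
  have sum: "a + b \<in> PG_points d \<and> a + b \<noteq> a \<and> a + b \<noteq> b"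
    if "a \<in> PG_points d" "b \<in> PG_points d" "a \<noteq> b" for a b
  proof -
    have c: "a \<in> carrier_vec (d+1)" "b \<in> carrier_vec (d+1)" "a \<noteq> 0\<^sub>v (d+1)" "b \<noteq> 0\<^sub>v (d+1)"
      using that by (auto simp: PG_points_def)
    have "a + b \<noteq> 0\<^sub>v (d+1)" using bit_vec_cancel(2) c that by blast
    moreover have "a + b \<noteq> a"
      using bit_vec_cancel[OF c(1) c(2)] bit_vec_cancel(2)[OF c(1) c(1)] c by metis
    moreover have "a + b \<noteq> b"
      using bit_vec_cancel[OF c(2) c(1)] bit_vec_cancel(2)[OF c(2) c(2)] c comm_add_vec by metis
    ultimately show ?thesis using c by (simp add: PG_points_def)
  qed
  show "T \<subseteq> PG_points d \<and> card T = 3" if T: "T \<in> PG_lines d" for T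
  proof -
    from T obtain a b where ab: "T = {a, b, a + b}" "a \<in> PG_points d" "b \<in> PG_points d" "a \<noteq> b"
      by (auto simp: PG_lines_def)
    from sum[OF ab(2-4)] ab show ?thesis by auto
  qed
  show "\<exists>!T. T \<in> PG_lines d \<and> {x, y} \<subseteq> T"
    if xy: "x \<in> PG_points d" "y \<in> PG_points d" "x \<noteq> y" for x y
  proof (rule ex1I[of _ "{x, y, x + y}"])
    show "{x, y, x + y} \<in> PG_lines d \<and> {x, y} \<subseteq> {x, y, x + y}"
      using xy by (auto simp: PG_lines_def)
  next
    fix T assume T: "T \<in> PG_lines d \<and> {x, y} \<subseteq> T"
    then obtain a b where ab: "T = {a, b, a + b}" "a \<in> PG_points d" "b \<in> PG_points d" "a \<noteq> b"
      by (auto simp: PG_lines_def)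
    have c: "a \<in> carrier_vec (d+1)" "b \<in> carrier_vec (d+1)"
      using ab by (auto simp: PG_points_def)
    have e: "a + b = b + a" "a + (a + b) = b" "b + (a + b) = a" "(a + b) + a = b" "(a + b) + b = a"
      using bit_vec_cancel(1)[OF c] bit_vec_cancel(1)[OF c(2) c(1)] comm_add_vec[OF c]
        comm_add_vec[of "a + b" "d+1" a] comm_add_vec[of "a + b" "d+1" b] c by auto
    have "x = a \<or> x = b \<or> x = a + b" "y = a \<or> y = b \<or> y = a + b"
      using T ab(1) by auto
    then show "T = {x, y, x + y}"
      using xy(3) ab(1) e by (elim disjE) (auto simp: insert_commute)
  qed
qed

end

theory Submission
  imports Defs
begin

text \<open>Adjoining a point to a proper subsystem with \<open>w\<close> points generates a subsystem with at least
  \<open>2 w + 1\<close> points. Hence, if no spreading set has fewer than \<open>log 2 (n + 1)\<close> points, no doubling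
  step can overshoot, and three non-collinear points always generate a Fano plane. This makes the
  partial operation that sends two points to the third point of their triple, completed by a neutral
  element, the addition of an elementary abelian 2-group. A smallest spreading set generates this
  group, so the linear combination map of such a set is a surjection from the vectors of length
  \<open>log 2 (n + 1)\<close> onto a group of the same order.\<close>

section \<open>Counting vectors over the two-element field\<close>

lemma card_carrier_vec_bit: "card (carrier_vec k :: bit vec set) = 2 ^ k"
proof -
  have U: "(UNIV :: bit set) = {0, 1}" by (auto simp: bit_not_zero_iff)
  have "bij_betw vec_of_list {xs :: bit list. set xs \<subseteq> UNIV \<and> length xs = k} (carrier_vec k)"
    by (rule bij_betw_byWitness[where f' = list_of_vec]) (auto simp: list_vec vec_list intro: carrier_vecI)
  then have "card (carrier_vec k :: bit vec set) = card {xs :: bit list. set xs \<subseteq> UNIV \<and> length xs = k}"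
    using bij_betw_same_card by metis
  also have "\<dots> = card (UNIV :: bit set) ^ k"
    by (rule card_lists_length_eq) (simp add: U)
  finally show ?thesis by (simp add: U numeral_2_eq_2)
qed

section \<open>The third-point operation\<close>

context steiner_triple_system
begin

definition third :: "'a \<Rightarrow> 'a \<Rightarrow> 'a" where
  "third x y = (THE z. {x, y, z} \<in> F)"

lemma triple_distinct:
  assumes "{x, y, z} \<in> F"
  shows "x \<noteq> y" "x \<noteq> z" "y \<noteq> z" "x \<in> V" "y \<in> V" "z \<in> V"
proof -
  from triples[OF assms] have c: "card {x, y, z} = 3" and s: "{x, y, z} \<subseteq> V" by auto
  from c show "x \<noteq> y" "x \<noteq> z" "y \<noteq> z" by (auto simp: card_insert_if split: if_splits)
  from s show "x \<in> V" "y \<in> V" "z \<in> V" by auto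
qed

lemma third_eqI:
  assumes "{x, y, z} \<in> F"
  shows "third x y = z"
  unfolding third_def
proof (rule the_equality)
  fix w assume w: "{x, y, w} \<in> F"
  have "{x, y, w} = {x, y, z}"
    using unique_triple[of x y] triple_distinct[OF assms] assms w by blast
  then show "w = z" using triple_distinct[OF w] triple_distinct[OF assms] by auto
qed (rule assms)

lemma third_triple:
  assumes "x \<in> V" "y \<in> V" "x \<noteq> y"
  shows "{x, y, third x y} \<in> F"
proof -
  from unique_triple[OF assms] obtain T where T: "T \<in> F" "{x, y} \<subseteq> T" by blast
  from triples[OF T(1)] have "card T = 3" "finite T" by (auto intro: card_ge_0_finite)
  then have "card (T - {x, y}) = 1" using T(2) assms(3) by (simp add: card_Diff_subset)
  then obtain z where "T - {x, y} = {z}" by (auto simp: card_1_singleton_iff)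
  then have "T = {x, y, z}" using T(2) by auto
  with T(1) have "{x, y, z} \<in> F" by simp
  then show ?thesis using third_eqI by metis
qed

lemma third_commute: "third x y = third y x"
  by (simp add: third_def insert_commute)

lemma third_props:
  assumes "x \<in> V" "y \<in> V" "x \<noteq> y"
  shows "third x y \<in> V" "third x y \<noteq> x" "third x y \<noteq> y" "third x (third x y) = y"
proof -
  note t = third_triple[OF assms]
  show "third x y \<in> V" "third x y \<noteq> x" "third x y \<noteq> y"
    using triple_distinct[OF t] by auto
  have "{x, third x y, y} = {x, y, third x y}" by auto
  with t show "third x (third x y) = y" by (intro third_eqI) (simp only:)
qed

text \<open>On \<open>V - {x}\<close> the map \<open>third x\<close> is an involution, hence
  injective.\<close>

lemma third_cancel:
  assumes "x \<in> V" "y \<in> V" "z \<in> V" "x \<noteq> y" "x \<noteq> z" "third x y = third x z"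
  shows "y = z"
proof -
  have "y = third x (third x y)" by (rule third_props(4)[OF assms(1,2,4), symmetric])
  also have "\<dots> = third x (third x z)" by (simp only: assms(6))
  also have "\<dots> = z" by (rule third_props(4)[OF assms(1,3,5)])
  finally show ?thesis .
qed

section \<open>Subsystems and the growth of closures\<close>

lemma third_closed:
  assumes "neighbours V F W = {}" "W \<subseteq> V" "x \<in> W" "y \<in> W" "x \<noteq> y"
  shows "third x y \<in> W"
proof (rule ccontr)
  assume "third x y \<notin> W"
  moreover have "x \<in> V" "y \<in> V" using assms(2-4) by auto
  note third_triple[OF this assms(5)] third_props(1)[OF this assms(5)]
  ultimately have "third x y \<in> neighbours V F W"
    using assms(3-5) by (auto simp: neighbours_def)
  with assms(1) show False by simp
qed

text \<open>Converse of \<open>third_closed\<close>: for subsets of \<open>V\<close>, having no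
  neighbours amounts to being closed under \<open>third\<close>.\<close>

lemma neighbours_emptyI:
  assumes "\<And>x y. x \<in> W \<Longrightarrow> y \<in> W \<Longrightarrow> x \<noteq> y \<Longrightarrow> third x y \<in> W"
  shows "neighbours V F W = {}"
proof -
  have False if "z \<notin> W" "x \<in> W" "y \<in> W" "x \<noteq> y" "{x, y, z} \<in> F" for x y z
    using assms[of x y] third_eqI[OF that(5)] that by simp
  then show ?thesis unfolding neighbours_def by blast
qed

text \<open>The larger closure contains the old closure, the point \<open>x\<close>, and the image
  of the old closure under the injective map \<open>third x\<close>. These are disjoint, so
  \<open>w\<close> points grow to at least \<open>2 * w + 1\<close>. Adding one on both sides turns
  this into plain doubling, which iterates well.\<close>

lemma card_closure_insert:
  assumes "A \<subseteq> V" "x \<in> V" "x \<notin> sts_closure V F A"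
  shows "2 * (card (sts_closure V F A) + 1) \<le> card (sts_closure V F (insert x A)) + 1"
proof -
  let ?W = "sts_closure V F A" and ?U = "sts_closure V F (insert x A)"
  note W = sts_closure_least[OF assms(1)]
  have xA: "insert x A \<subseteq> V" using assms by simp
  note U = sts_closure_least[OF xA]
  have WU: "?W \<subseteq> ?U" using W(4)[of ?U] U by auto
  have xU: "x \<in> ?U" using U(1) by auto
  have fin: "finite ?U" "finite ?W"
    by (rule finite_subset[OF U(2) finite_points], rule finite_subset[OF W(2) finite_points])
  have inj: "inj_on (third x) ?W"
  proof (rule inj_onI)
    fix v w assume "v \<in> ?W" "w \<in> ?W" "third x v = third x w"
    moreover from this have "v \<in> V" "w \<in> V" "x \<noteq> v" "x \<noteq> w" using W(2) assms(3) by auto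
    ultimately show "v = w" by (metis third_cancel[OF assms(2), of v w])
  qed
  have imU: "third x ` ?W \<subseteq> ?U"
  proof (rule image_subsetI)
    fix w assume "w \<in> ?W"
    with assms(3) have "x \<noteq> w" by blast
    with \<open>w \<in> ?W\<close> WU show "third x w \<in> ?U" by (intro third_closed[OF U(3,2) xU]) (rule subsetD)
  qed
  \<comment> \<open>If \<open>third x w\<close> lay in the old closure, then so would the third
    point of \<open>w\<close> and \<open>third x w\<close>, which is \<open>x\<close>.\<close>
  have disj: "third x w \<notin> insert x ?W" if w: "w \<in> ?W" for w
  proof
    have w': "w \<in> V" "x \<noteq> w" using w W(2) assms(3) by auto
    note p = third_props[OF assms(2) w']
    assume "third x w \<in> insert x ?W"
    then have "third x w \<in> ?W" using p(2) by simp
    then have "third w (third x w) \<in> ?W" using third_closed[OF W(3,2) w] p(3) by metis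
    then show False
      using third_props(4)[OF w'(1) assms(2)] w'(2) assms(3) third_commute[of x w] by simp
  qed
  then have "insert x ?W \<inter> third x ` ?W = {}"
    by (intro equals0I) (metis IntE imageE)
  then have "card (insert x ?W \<union> third x ` ?W) = (card ?W + 1) + card ?W"
    using fin assms(3) by (subst card_Un_disjoint) (simp_all add: card_image[OF inj])
  moreover have "card (insert x ?W \<union> third x ` ?W) \<le> card ?U"
    using WU xU imU fin by (intro card_mono) auto
  ultimately show ?thesis by simp
qed

text \<open>Greedy extension: as long as the closure is not \<open>V\<close>, adjoin a point outside
  it. Each new point at least doubles the closure size plus one, and this quantity never exceeds
  \<open>card V + 1\<close>.\<close>

lemma extend_to_spreading:
  assumes "A \<subseteq> V"
  shows "\<exists>B. A \<subseteq> B \<and> spreading V F B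
    \<and> (card (sts_closure V F A) + 1) * 2 ^ (card B - card A) \<le> card V + 1"
  using assms
proof (induction "card (V - A)" arbitrary: A rule: less_induct)
  case less
  note cl = sts_closure_least[OF less.prems]
  show ?case
  proof (cases "sts_closure V F A = V")
    case True
    then show ?thesis using less.prems by (intro exI[of _ A]) (simp add: spreading_def)
  next
    case False
    then obtain x where x: "x \<in> V" "x \<notin> sts_closure V F A" using cl by blast
    then have xA: "x \<notin> A" using cl(1) by blast
    have "card (V - insert x A) < card (V - A)"
      using x xA finite_points by (intro psubset_card_mono) auto
    from less.hyps[OF this] x less.prems obtain B where B: "insert x A \<subseteq> B" "spreading V F B"
      "(card (sts_closure V F (insert x A)) + 1) * 2 ^ (card B - card (insert x A)) \<le> card V + 1"
      by auto
    have finB: "finite B" using B(2) finite_points by (auto simp: spreading_def intro: finite_subset)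
    then have finA: "finite A" using B(1) by (auto intro: finite_subset)
    \<comment> \<open>This keeps the subtraction on naturals from truncating, so the exponent really
      drops by one.\<close>
    have "card (insert x A) \<le> card B" by (rule card_mono[OF finB B(1)])
    then have e: "card B - card A = Suc (card B - card (insert x A))"
      using xA finA by simp
    have "(card (sts_closure V F A) + 1) * 2 ^ (card B - card A)
        = 2 * (card (sts_closure V F A) + 1) * 2 ^ (card B - card (insert x A))"
      by (simp only: e power_Suc mult_ac)
    also have "\<dots> \<le> (card (sts_closure V F (insert x A)) + 1) * 2 ^ (card B - card (insert x A))"
      using card_closure_insert[OF less.prems x] by (rule mult_right_mono) simp
    finally show ?thesis using B by (intro exI[of _ B]) auto
  qed
qed

section \<open>Three points generate at most a Fano plane\<close>

lemma min_spreading_size_le: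
  assumes "spreading V F B"
  shows "min_spreading_size V F \<le> card B"
  unfolding min_spreading_size_def by (rule Least_le) (use assms in blast)

lemma min_spreading_size_attained: "\<exists>B. spreading V F B \<and> card B = min_spreading_size V F"
  unfolding min_spreading_size_def
  by (rule LeastI_ex[where P = "\<lambda>k. \<exists>A. spreading V F A \<and> card A = k"])
    (use spreading_points in blast)

text \<open>Extend the three points greedily to a spreading set \<open>B\<close>. By minimality
  \<open>card V + 1\<close> is at most \<open>2 ^ card B\<close>, which is
  \<open>8 * 2 ^ (card B - 3)\<close>. The doubling bound for the \<open>card B - 3\<close> added
  points then leaves at most 8 for the closure size plus one.\<close>

lemma card_plane_le:
  assumes "card V + 1 \<le> 2 ^ min_spreading_size V F" "{x, y, z} \<subseteq> V" "card {x, y, z} = 3"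
  shows "card (sts_closure V F {x, y, z}) \<le> 7"
proof -
  let ?c = "card (sts_closure V F {x, y, z}) + 1"
  obtain B where B: "{x, y, z} \<subseteq> B" "spreading V F B" "?c * 2 ^ (card B - 3) \<le> card V + 1"
    using extend_to_spreading[OF assms(2)] assms(3) by auto
  have "finite B" using B(2) finite_points by (auto simp: spreading_def intro: finite_subset)
  then have "3 \<le> card B" using card_mono[OF _ B(1)] assms(3) by simp
  then have "(2::nat) ^ card B = 8 * 2 ^ (card B - 3)"
    using power_add[of "2::nat" 3 "card B - 3"] by simp
  moreover have "(2::nat) ^ min_spreading_size V F \<le> 2 ^ card B"
    using min_spreading_size_le[OF B(2)] by simp
  ultimately have "?c * 2 ^ (card B - 3) \<le> 8 * 2 ^ (card B - 3)"
    using B(3) assms(1) by linarith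
  then show ?thesis by simp
qed

text \<open>The closure of three non-collinear points contains seven explicit distinct points, so by
  \<open>card_plane_le\<close> it consists of exactly these. The right-hand side lies in this
  closure, and every candidate other than the left-hand side can be excluded.\<close>

lemma third_assoc:
  assumes min: "card V + 1 \<le> 2 ^ min_spreading_size V F"
    and V: "x \<in> V" "y \<in> V" "z \<in> V"
    and ne: "x \<noteq> y" "x \<noteq> z" "y \<noteq> z" "third x y \<noteq> z"
  shows "third (third x y) z = third x (third y z)"
proof -
  define s t u where "s = third x y" and "t = third y z" and "u = third x z"
  define w p where "w = third s z" and "p = third x t"
  let ?P = "sts_closure V F {x, y, z}"
  have sub: "{x, y, z} \<subseteq> V" using V by simp
  note P = sts_closure_least[OF sub]
  note closed = third_closed[OF P(3,2)]
  have s: "s \<in> V" "s \<noteq> x" "s \<noteq> y" "third x s = y" "third y s = x"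
    using third_props[of x y] third_props[of y x] V ne third_commute[of x y]
    by (auto simp: s_def)
  have t: "t \<in> V" "t \<noteq> y" "t \<noteq> z" "third y t = z" "third z t = y"
    using third_props[of y z] third_props[of z y] V ne third_commute[of y z]
    by (auto simp: t_def)
  have u: "u \<in> V" "u \<noteq> x" "u \<noteq> z" "third x u = z" "third z u = x"
    using third_props[of x z] third_props[of z x] V ne third_commute[of x z]
    by (auto simp: u_def)
  have sz: "s \<noteq> z" using ne by (simp add: s_def)
  have w: "w \<in> V" "w \<noteq> s" "w \<noteq> z" "third s w = z" "third z w = s"
    using third_props[of s z] third_props[of z s] V s(1) sz third_commute[of s z]
    by (auto simp: w_def)
  have zx: "third z x = u" and zy: "third z y = t"
    by (simp_all only: u_def t_def third_commute)
  \<comment> \<open>Two of these third points share a generator. If they were equal, applying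
    \<open>third\<close> with that generator would identify two of \<open>x\<close>,
    \<open>y\<close>, \<open>z\<close>.\<close>
  have st: "s \<noteq> t" and su: "s \<noteq> u" and tu: "t \<noteq> u"
    using s(4,5) t(4,5) u(4,5) ne by auto
  \<comment> \<open>For \<open>w\<close>, apply \<open>third z\<close>: it sends \<open>w\<close> to
    \<open>s\<close>, but \<open>x\<close>, \<open>y\<close>, \<open>t\<close>, \<open>u\<close> to
    \<open>u\<close>, \<open>t\<close>, \<open>y\<close>, \<open>x\<close>, all different from
    \<open>s\<close>. The first two inequalities reduce to non-collinearity,
    \<open>s \<noteq> z\<close>.\<close>
  have d: "t \<noteq> x" "u \<noteq> y" "w \<noteq> x" "w \<noteq> y" "w \<noteq> t" "w \<noteq> u"
    using t(4) s(2,3,4) u(4) zx zy w(5) t(5) u(5) st su sz third_commute[of x y] s_def by auto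
  have "{x, y, z, s, t, u, w} \<subseteq> ?P"
  proof -
    have "x \<in> ?P" "y \<in> ?P" "z \<in> ?P" using P(1) by auto
    moreover from this have "s \<in> ?P" "t \<in> ?P" "u \<in> ?P"
      using closed ne by (auto simp: s_def t_def u_def)
    moreover from this calculation have "w \<in> ?P" using closed sz by (auto simp: w_def)
    ultimately show ?thesis by simp
  qed
  moreover have "card {x, y, z, s, t, u, w} = 7"
    using s(2,3) t(2,3) u(2,3) w(2,3) d st su tu sz ne by (simp add: card_insert_if)
  moreover have "card ?P \<le> 7"
    using card_plane_le[OF min sub] ne by simp
  moreover have "finite ?P" using P(2) finite_points finite_subset by blast
  ultimately have PE: "?P = {x, y, z, s, t, u, w}"
    using card_seteq by metis
  then have "x \<in> ?P" "t \<in> ?P" by auto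
  then have "p \<in> ?P" using closed[of x t] d(1) by (simp add: p_def)
  moreover have p: "p \<noteq> x" "p \<noteq> t" "third x p = t"
    using third_props[of x t] V t(1) d(1) by (auto simp: p_def)
  \<comment> \<open>Since \<open>third x p = t\<close>, these four values of \<open>p\<close> would
    force \<open>t\<close> to be \<open>s\<close>, \<open>u\<close>, \<open>y\<close> or
    \<open>z\<close>, respectively.\<close>
  moreover have "p \<noteq> y" "p \<noteq> z" "p \<noteq> s" "p \<noteq> u"
    using p(3) s(4) u(4) t(2,3) st tu by (auto simp: s_def u_def)
  ultimately have "p = w" using PE by blast
  then show ?thesis by (simp add: p_def w_def s_def t_def)
qed

section \<open>The elementary abelian 2-group on the points and a zero\<close>

fun opt_add :: "'a option \<Rightarrow> 'a option \<Rightarrow> 'a option" where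
  "opt_add None b = b"
| "opt_add a None = a"
| "opt_add (Some x) (Some y) = (if x = y then None else Some (third x y))"

lemma opt_add_None_right [simp]: "opt_add a None = a"
  by (cases a) auto

lemma opt_add_commute: "opt_add a b = opt_add b a"
  by (cases a; cases b) (auto simp: third_commute)

lemma opt_add_self [simp]: "opt_add a a = None"
  by (cases a) auto

lemma opt_add_in:
  assumes "a \<in> insert None (Some ` V)" "b \<in> insert None (Some ` V)"
  shows "opt_add a b \<in> insert None (Some ` V)"
proof (cases a; cases b)
  fix x y assume xy: "a = Some x" "b = Some y"
  then show ?thesis using assms third_props(1)[of x y] by auto
qed (use assms in simp_all)

text \<open>This instance of associativity, with two equal summands, holds in every Steiner triple
  system: for distinct points it is the involution property of \<open>third\<close>.\<close>

lemma opt_add_left_self: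
  assumes "a \<in> insert None (Some ` V)" "b \<in> insert None (Some ` V)"
  shows "opt_add a (opt_add a b) = b"
proof (cases "\<exists>x y. a = Some x \<and> b = Some y \<and> x \<noteq> y")
  case True
  then obtain x y where xy: "a = Some x" "b = Some y" "x \<noteq> y" by blast
  then have "x \<in> V" "y \<in> V" using assms by auto
  note third_props[OF this xy(3)]
  then show ?thesis using xy by auto
next
  case False
  then show ?thesis by (cases a; cases b) auto
qed

text \<open>A zero or a repeated argument is settled by \<open>opt_add_left_self\<close> and
  commutativity. For three distinct collinear points both sides are \<open>None\<close>. The
  non-collinear case is \<open>third_assoc\<close>.\<close>

lemma opt_add_assoc:
  assumes min: "card V + 1 \<le> 2 ^ min_spreading_size V F"
    and G: "a \<in> insert None (Some ` V)" "b \<in> insert None (Some ` V)" "c \<in> insert None (Some ` V)"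
  shows "opt_add (opt_add a b) c = opt_add a (opt_add b c)"
proof -
  consider "a = None \<or> b = None \<or> c = None" | "a = b" | "b = c" | "a = c"
    | x y z where "a = Some x" "b = Some y" "c = Some z" "x \<noteq> y" "x \<noteq> z" "y \<noteq> z"
    by (cases a; cases b; cases c) auto
  then show ?thesis
  proof cases
    case 1
    then show ?thesis by auto
  next
    case 2
    then show ?thesis using opt_add_left_self[OF G(2,3)] by simp
  next
    case 3
    then show ?thesis using opt_add_left_self[OF G(2,1)] by (simp add: opt_add_commute)
  next
    case 4
    then show ?thesis by (simp add: opt_add_commute)
  next
    case (5 x y z)
    then have V: "x \<in> V" "y \<in> V" "z \<in> V" using G by auto
    show ?thesis
    proof (cases "third x y = z")
      case True
      then have "third y z = x"
        using third_props(4)[of y x] V 5 third_commute[of x y] by simp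
      with True 5 show ?thesis by simp
    next
      case False
      \<comment> \<open>Non-collinearity seen from the other bracketing, so that the right-hand side
        is a point as well and not \<open>None\<close>.\<close>
      then have "third y z \<noteq> x"
        using third_props(4)[of y z] V 5 third_commute[of x y] by auto
      with False 5 third_assoc[OF min V 5(4-6) False] show ?thesis by auto
    qed
  qed
qed

section \<open>Linear combinations of a smallest spreading set\<close>

primrec lin_comb :: "(nat \<Rightarrow> 'a) \<Rightarrow> nat \<Rightarrow> bit vec \<Rightarrow> 'a option" where
  "lin_comb b 0 v = None"
| "lin_comb b (Suc i) v =
    (if v $ i = 1 then opt_add (Some (b i)) (lin_comb b i v) else lin_comb b i v)"

lemma lin_comb_in:
  assumes "\<And>j. j < i \<Longrightarrow> b j \<in> V"
  shows "lin_comb b i v \<in> insert None (Some ` V)"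
  using assms
proof (induction i)
  case (Suc i)
  then have "lin_comb b i v \<in> insert None (Some ` V)" "Some (b i) \<in> insert None (Some ` V)" by auto
  from opt_add_in[OF this(2,1)] this(1) show ?case by simp
qed simp

text \<open>The recursion fixes one bracketing of the sum, so additivity is where the group laws are
  used: the contributions of coordinate \<open>i\<close> are regrouped and added.\<close>

lemma lin_comb_add:
  assumes min: "card V + 1 \<le> 2 ^ min_spreading_size V F"
    and "\<And>j. j < i \<Longrightarrow> b j \<in> V" "i \<le> k" "v \<in> carrier_vec k" "w \<in> carrier_vec k"
  shows "lin_comb b i (v + w) = opt_add (lin_comb b i v) (lin_comb b i w)"
  using assms(2,3)
proof (induction i)
  case (Suc i)
  let ?e = "Some (b i)" and ?p = "lin_comb b i v" and ?q = "lin_comb b i w"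
  have G: "?e \<in> insert None (Some ` V)" "?p \<in> insert None (Some ` V)" "?q \<in> insert None (Some ` V)"
    using lin_comb_in[of i b] Suc.prems by auto
  note Gpq = opt_add_in[OF G(2,3)] opt_add_in[OF G(1,2)] opt_add_in[OF G(1,3)]
  have IH: "lin_comb b i (v + w) = opt_add ?p ?q" using Suc by simp
  have vw: "(v + w) $ i = v $ i + w $ i" using Suc.prems assms by auto
  \<comment> \<open>Facts 1, 2 and 3 treat the values (1,0), (0,1) and (1,1) of \<open>v $ i\<close>
    and \<open>w $ i\<close>. In the last case the two copies of \<open>b i\<close> cancel, matching
    \<open>1 + 1 = 0\<close>.\<close>
  have 1: "opt_add (opt_add ?e ?p) ?q = opt_add ?e (opt_add ?p ?q)"
    by (rule opt_add_assoc[OF min G])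
  have 2: "opt_add ?p (opt_add ?e ?q) = opt_add ?e (opt_add ?p ?q)"
    using opt_add_assoc[OF min G(2,1,3)] 1 opt_add_commute[of ?e ?p] by simp
  have 3: "opt_add (opt_add ?e ?p) (opt_add ?e ?q) = opt_add ?p ?q"
    using opt_add_assoc[OF min G(1,2) Gpq(3)] 2 opt_add_left_self[OF G(1) Gpq(1)] by simp
  show ?case
    by (cases "v $ i"; cases "w $ i") (simp_all add: IH vw 1 2 3)
qed simp

lemma lin_comb_zero: "i \<le> k \<Longrightarrow> lin_comb b i (0\<^sub>v k) = None"
  by (induction i) auto

lemma lin_comb_unit:
  assumes "j < k" "i \<le> k"
  shows "lin_comb b i (unit_vec k j) = (if j < i then Some (b j) else None)"
  using assms(2)
proof (induction i)
  case (Suc i)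
  then have "unit_vec k j $ i = (if i = j then 1 else 0 :: bit)"
    using assms(1) by (auto simp: unit_vec_def)
  with Suc show ?case by auto
qed simp

text \<open>Let \<open>b\<close> enumerate a smallest spreading set. The points in the image of the
  linear combination map form a subsystem containing that set, hence all of \<open>V\<close>. The
  map is thus onto, and injectivity follows because both sides have the same finite size.\<close>

lemma lin_comb_bij:
  assumes card_V: "card V + 1 = 2 ^ min_spreading_size V F"
  obtains b where "bij_betw (lin_comb b (min_spreading_size V F))
      (carrier_vec (min_spreading_size V F)) (insert None (Some ` V))"
    "\<And>j. j < min_spreading_size V F \<Longrightarrow> b j \<in> V"
proof -
  let ?k = "min_spreading_size V F"
  have min: "card V + 1 \<le> 2 ^ ?k" using card_V by simp
  obtain B where B: "spreading V F B" "card B = ?k"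
    using min_spreading_size_attained by blast
  then have BV: "B \<subseteq> V" by (simp add: spreading_def)
  then have "finite B" using finite_points by (rule finite_subset)
  then obtain b where b: "bij_betw b {0..<?k} B"
    using ex_bij_betw_nat_finite[of B] B(2) by auto
  let ?\<phi> = "lin_comb b ?k" and ?C = "carrier_vec ?k :: bit vec set"
  have bV: "b j \<in> V" if "j < ?k" for j
  proof -
    have "b j \<in> B" using bij_betwE[OF b] that by simp
    then show ?thesis using BV by (rule subsetD[rotated])
  qed
  have \<phi>_in: "?\<phi> v \<in> insert None (Some ` V)" for v
    by (rule lin_comb_in) (rule bV)
  have add: "?\<phi> (v + w) = opt_add (?\<phi> v) (?\<phi> w)" if "v \<in> ?C" "w \<in> ?C" for v w
    using lin_comb_add[OF min bV _ that] by simp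
  let ?W = "{x. Some x \<in> ?\<phi> ` ?C}"
  have "neighbours V F ?W = {}"
  proof (rule neighbours_emptyI)
    fix x y assume xy: "x \<in> ?W" "y \<in> ?W" "x \<noteq> y"
    then obtain v w where vw: "v \<in> ?C" "Some x = ?\<phi> v" "w \<in> ?C" "Some y = ?\<phi> w"
      by blast
    \<comment> \<open>Additivity makes the image closed under \<open>opt_add\<close>, which on
      distinct points is \<open>third\<close>.\<close>
    then have "?\<phi> (v + w) = Some (third x y)" using add[OF vw(1,3)] xy(3) by (simp flip: vw(2,4))
    moreover have "v + w \<in> ?C" using vw by simp
    ultimately show "third x y \<in> ?W" by (metis image_eqI mem_Collect_eq)
  qed
  moreover have "?W \<subseteq> V"
  proof
    fix x assume "x \<in> ?W"
    then obtain v where "Some x = ?\<phi> v" by blast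
    with \<phi>_in[of v] have "Some x \<in> insert None (Some ` V)" by (simp only:)
    then show "x \<in> V" by auto
  qed
  moreover have "B \<subseteq> ?W"
  proof
    fix x assume "x \<in> B"
    then obtain j where j: "j < ?k" "x = b j"
      using bij_betw_imp_surj_on[OF b] by (metis imageE atLeastLessThan_iff)
    then have "?\<phi> (unit_vec ?k j) = Some x" using lin_comb_unit[of j ?k ?k b] by simp
    then show "x \<in> ?W" by (metis image_eqI mem_Collect_eq unit_vec_carrier)
  qed
  ultimately have "sts_closure V F B \<subseteq> ?W"
    by (intro sts_closure_least(4)[OF BV])
  then have "V \<subseteq> ?W" using B(1) by (simp only: spreading_def)
  moreover have "None \<in> ?\<phi> ` ?C"
    by (metis image_eqI le_refl lin_comb_zero zero_carrier_vec)
  ultimately have "insert None (Some ` V) \<subseteq> ?\<phi> ` ?C" by blast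
  then have im: "?\<phi> ` ?C = insert None (Some ` V)"
    using \<phi>_in by (intro equalityI image_subsetI)
  \<comment> \<open>The zero \<open>None\<close> accounts for the summand 1 in
    \<open>card V + 1\<close>.\<close>
  have "card (insert None (Some ` V)) = card ?C"
    using card_V finite_points by (simp add: card_carrier_vec_bit card_image)
  then have "inj_on ?\<phi> ?C"
    using im by (intro eq_card_imp_inj_on finite_carrier_vec_bit) simp
  with im have "bij_betw ?\<phi> ?C (insert None (Some ` V))" by (simp only: bij_betw_def)
  then show ?thesis using bV by (rule that)
qed

section \<open>The isomorphism with the projective space\<close>

lemma isomorphic_PG:
  assumes card_V: "card V + 1 = 2 ^ min_spreading_size V F"
  shows "sts_isomorphic V F (PG_points (min_spreading_size V F - 1))
    (PG_lines (min_spreading_size V F - 1))"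
proof -
  let ?k = "min_spreading_size V F"
  let ?d = "?k - 1"
  have min: "card V + 1 \<le> 2 ^ ?k" using card_V by simp
  \<comment> \<open>A nonempty \<open>V\<close> rules out exponent 0, so the truncated
    \<open>?k - 1\<close> is a genuine predecessor and the vectors of \<open>PG_points ?d\<close>
    have length \<open>?k\<close>.\<close>
  have "card V > 0" using finite_points nonempty_points by (simp add: card_gt_0_iff)
  then have "?k > 0" using card_V by (cases "?k = 0") auto
  then have kd: "?d + 1 = ?k" by simp
  obtain b where bij: "bij_betw (lin_comb b ?k) (carrier_vec ?k) (insert None (Some ` V))"
    and bV: "\<And>j. j < ?k \<Longrightarrow> b j \<in> V"
    using lin_comb_bij[OF card_V] by blast
  let ?\<phi> = "lin_comb b ?k"
  define g where "g v = the (?\<phi> v)" for v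
  have zero: "?\<phi> (0\<^sub>v ?k) = None" by (simp add: lin_comb_zero)
  have P: "PG_points ?d = carrier_vec ?k - {0\<^sub>v ?k}" by (simp only: PG_points_def kd)
  \<comment> \<open>Removing the zero on each side leaves the projective points and the points of
    \<open>V\<close>, so \<open>the\<close> in \<open>g\<close> is only used on proper values
    there.\<close>
  have "bij_betw ?\<phi> (PG_points ?d) (insert None (Some ` V) - {None})"
    unfolding P using bij_betw_DiffI[OF bij, of "{0\<^sub>v ?k}" "{None}"] zero by (simp add: bij_betw_def)
  then have bij': "bij_betw ?\<phi> (PG_points ?d) (Some ` V)"
    by (metis Diff_insert_absorb imageE option.distinct(1))
  moreover have "bij_betw the (Some ` V) V"
    by (rule bij_betw_byWitness[where f' = Some]) auto
  ultimately have g: "bij_betw g (PG_points ?d) V"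
    using bij_betw_trans by (fastforce simp: g_def[abs_def] comp_def)
  have Some_g: "?\<phi> v = Some (g v)" if "v \<in> PG_points ?d" for v
    using bij_betwE[OF bij'] that by (auto simp: g_def)
  have gV: "g v \<in> V" if "v \<in> PG_points ?d" for v
    using bij_betwE[OF g] that by blast
  have g_add: "g (v + w) = third (g v) (g w)" and g_ne: "g v \<noteq> g w"
    if "v \<in> PG_points ?d" "w \<in> PG_points ?d" "v \<noteq> w" for v w
  proof -
    show ne: "g v \<noteq> g w" using g that by (auto simp: bij_betw_def inj_on_def)
    have "?\<phi> (v + w) = opt_add (?\<phi> v) (?\<phi> w)"
      using that by (intro lin_comb_add[OF min bV]) (simp_all only: P, auto)
    then show "g (v + w) = third (g v) (g w)"
      using Some_g[OF that(1)] Some_g[OF that(2)] ne by (simp add: g_def[of "v + w"])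
  qed
  \<comment> \<open>Since \<open>g\<close> turns sums of distinct vectors into third points, lines
    map to triples. Conversely, two points of a triple have preimages, and these determine a line
    mapping onto it.\<close>
  have img: "(\<lambda>T. g ` T) ` PG_lines ?d = F"
  proof (intro equalityI subsetI)
    fix T assume "T \<in> (\<lambda>T. g ` T) ` PG_lines ?d"
    then obtain v w where vw: "v \<in> PG_points ?d" "w \<in> PG_points ?d" "v \<noteq> w" "T = g ` {v, w, v + w}"
      by (auto simp: PG_lines_def)
    then show "T \<in> F"
      using third_triple[OF gV gV g_ne, of v w] g_add by simp
  next
    fix T assume T: "T \<in> F"
    then have "card T = 3" using triples by blast
    then obtain x y z where xyz: "T = {x, y, z}" by (auto simp: card_3_iff)
    note d = triple_distinct[OF T[unfolded xyz]]
    obtain v w where vw: "v \<in> PG_points ?d" "w \<in> PG_points ?d" "x = g v" "y = g w"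
      using d(4,5) bij_betw_imp_surj_on[OF g] by blast
    then have "v \<noteq> w" using d(1) by blast
    moreover from this have "T = g ` {v, w, v + w}"
      using vw g_add xyz third_eqI[OF T[unfolded xyz]] by simp
    ultimately show "T \<in> (\<lambda>T. g ` T) ` PG_lines ?d"
      using vw unfolding PG_lines_def by blast
  qed
  \<comment> \<open>The isomorphism must go from \<open>V\<close> to the projective space, so
    \<open>g\<close> is inverted and the equation for the lines is carried back along the
    inverse.\<close>
  define f where "f = the_inv_into (PG_points ?d) g"
  have f: "bij_betw f V (PG_points ?d)"
    unfolding f_def using g by (rule bij_betw_the_inv_into)
  have fg: "f ` g ` T = T" if "T \<in> PG_lines ?d" for T
  proof -
    have "T \<subseteq> PG_points ?d"
      using steiner_triple_system.triples[OF steiner_triple_system_PG that] by blast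
    then have "f (g v) = v" if "v \<in> T" for v
      unfolding f_def using g that by (intro the_inv_into_f_f) (auto simp: bij_betw_def)
    then show ?thesis by (simp add: image_image)
  qed
  have "(\<lambda>T. f ` T) ` F = (\<lambda>T. f ` T) ` (\<lambda>T. g ` T) ` PG_lines ?d"
    by (simp only: img)
  also have "\<dots> = PG_lines ?d"
    by (simp add: image_image[of "(`) f" "(`) g"] fg del: One_nat_def)
  finally have "(\<lambda>T. f ` T) ` F = PG_lines ?d" .
  with f show ?thesis unfolding sts_isomorphic_def by blast
qed

end

theorem theorem1p4:
  fixes V :: "'a set" and F :: "'a set set" and n :: nat
  assumes "steiner_triple_system V F"
    and "card V = n"
    and "real (min_spreading_size V F) = log 2 (real n + 1)"
  shows "\<exists>d. sts_isomorphic V F (PG_points d) (PG_lines d)"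
proof -
  have "real n + 1 = 2 powr real (min_spreading_size V F)"
    unfolding assms(3) by simp
  then have "real (card V + 1) = real (2 ^ min_spreading_size V F)"
    using assms(2) by (simp add: powr_realpow)
  then have "card V + 1 = 2 ^ min_spreading_size V F"
    by (simp only: of_nat_eq_iff)
  from steiner_triple_system.isomorphic_PG[OF assms(1) this] show ?thesis by blast
qed

end
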